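(* Let $G=\{(x,y)\in\mathbb N^2:\gcd(x,y)=1\}$. Then $$\lim_{\min(n_1,n_2)\to\infty}\frac{\#(G\cap([n_1]\times [n_2]))}{n_1n_2}=\frac{6}{\pi^2}.$$ As a consequence $G\in\mathcal C_F^2$ and $\mu(G)=6/\pi^2$ for all $\mu\in\mathcal M_F^2$.
   Context: $\mathbb N=\{1,2,3,\dots\}$ and $[n]=\{1,\dots,n\}$. A finitely additive probability on a set $\Omega$ is a function $\mu:2^{\Omega}\to[0,1]$ with $\mu(\Omega)=1$ and $\mu(A\cup B)=\mu(A)+\mu(B)$ for disjoint $A,B\subseteq\Omega$. $\mathcal C_F^2$ is the collection of all $C\subseteq\mathbb N^2$ for which $\lim_{\min(n_1,n_2)\to\infty}\frac{\#(C\cap([n_1]\times[n_2]))}{n_1n_2}$ exists, and $\mathcal M_F^2$ is the set of all finitely additive probabilities $\mu$ on $\mathbb N^2$ (defined on all subsets) such that $\mu(C)$ equals this limit for every $C\in\mathcal C_F^2$. *)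

theory Defs
  imports "HOL-Analysis.Analysis"
begin

definition Npos :: "nat set" where
  "Npos = {1..}"

(* The mode of convergence min(n1,n2) --> infinity of double sequences. *)
definition min_at_top :: "(nat \<times> nat) filter" where
  "min_at_top = filtercomap (\<lambda>(n1, n2). min n1 n2) at_top"

definition rect_freq :: "(nat \<times> nat) set \<Rightarrow> nat \<times> nat \<Rightarrow> real" where
  "rect_freq C = (\<lambda>(n1, n2). real (card (C \<inter> {1..n1} \<times> {1..n2})) / (real n1 * real n2))"

(* Finitely additive probabilities are functions on the power set of Omega; as usual for
   functions on a carrier, they are taken to be undefined outside it. *)
definition finitely_additive_prob :: "'a set \<Rightarrow> ('a set \<Rightarrow> real) set" where
  "finitely_additive_prob \<Omega> =
     {\<mu> \<in> Pow \<Omega> \<rightarrow>\<^sub>E {0..1}. \<mu> \<Omega> = 1 \<and> additive (Pow \<Omega>) \<mu>}"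

definition CF2 :: "(nat \<times> nat) set set" where
  "CF2 = {C. C \<subseteq> Npos \<times> Npos \<and> (\<exists>l. (rect_freq C \<longlongrightarrow> l) min_at_top)}"

definition MF2 :: "((nat \<times> nat) set \<Rightarrow> real) set" where
  "MF2 = {\<mu> \<in> finitely_additive_prob (Npos \<times> Npos).
            \<forall>C\<in>CF2. (rect_freq C \<longlongrightarrow> \<mu> C) min_at_top}"

definition coprime_pairs :: "(nat \<times> nat) set" where
  "coprime_pairs = {(x, y) \<in> Npos \<times> Npos. gcd x y = 1}"

lemma eventually_min_at_top:
  "eventually P min_at_top \<longleftrightarrow> (\<exists>N. \<forall>n1 n2. min n1 n2 \<ge> N \<longrightarrow> P (n1, n2))"
proof
  assume "eventually P min_at_top"
  then obtain Q N where "\<forall>n\<ge>N. Q n" and "\<forall>n1 n2. Q (min n1 n2) \<longrightarrow> P (n1, n2)"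
    unfolding min_at_top_def eventually_filtercomap eventually_at_top_linorder by auto
  then show "\<exists>N. \<forall>n1 n2. min n1 n2 \<ge> N \<longrightarrow> P (n1, n2)"
    by blast
next
  assume "\<exists>N. \<forall>n1 n2. min n1 n2 \<ge> N \<longrightarrow> P (n1, n2)"
  then obtain N where "\<forall>n1 n2. min n1 n2 \<ge> N \<longrightarrow> P (n1, n2)" ..
  then show "eventually P min_at_top"
    unfolding min_at_top_def eventually_filtercomap eventually_at_top_linorder
    by (intro exI[of _ "\<lambda>n. n \<ge> N"]) auto
qed

lemma min_at_top_neq_bot: "min_at_top \<noteq> bot"
  unfolding trivial_limit_def eventually_min_at_top by (metis min.idem order_refl)

lemma min_at_top_eq_prod: "min_at_top = sequentially \<times>\<^sub>F sequentially"
  unfolding filter_eq_iff eventually_prod_sequentially eventually_min_at_top by auto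

end

theory Submission
  imports Defs
begin

text \<open>
  Sorting the pairs in \<open>[n\<^sub>1] \<times> [n\<^sub>2]\<close> by their gcd \<open>d\<close> gives, for the frequency
  \<open>f\<close> of the coprime pairs, the identity
  \<open>1 = (\<Sum>d\<ge>1. f (n\<^sub>1 div d, n\<^sub>2 div d) * w\<^sub>d)\<close>, where
  \<open>w\<^sub>d = (n\<^sub>1 div d) * (n\<^sub>2 div d) / (n\<^sub>1 * n\<^sub>2)\<close> is at most \<open>1 / d\<^sup>2\<close> and converges to it.
  The constant \<open>c = 6 / \<pi>\<^sup>2\<close> satisfies \<open>1 = (\<Sum>d\<ge>1. c / d\<^sup>2)\<close>. Subtracting and isolating
  \<open>d = 1\<close>, an eventual bound \<open>B\<close> on \<open>\<bar>f - c\<bar>\<close> improves to one close to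
  \<open>(\<Sum>d\<ge>2. 1 / d\<^sup>2) * B\<close>. This factor is less than 1, so iterating forces \<open>f \<longlongrightarrow> c\<close>;
  no Moebius inversion is needed.
\<close>

section \<open>Counting the pairs of a box by gcd\<close>

text \<open>Multiplying both coordinates by \<open>d\<close> is a bijection from the coprime pairs
  of the shrunken box onto the pairs with gcd \<open>d\<close>.\<close>

lemma card_gcd_eq:
  fixes d m n :: nat
  assumes "d > 0"
  shows "card {(x, y) \<in> {1..m} \<times> {1..n}. gcd x y = d} =
         card (coprime_pairs \<inter> {1..m div d} \<times> {1..n div d})"
proof -
  have "{(x, y) \<in> {1..m} \<times> {1..n}. gcd x y = d} =
        (\<lambda>(x, y). (d * x, d * y)) ` (coprime_pairs \<inter> {1..m div d} \<times> {1..n div d})"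
  proof (intro equalityI subsetI)
    fix p assume "p \<in> {(x, y) \<in> {1..m} \<times> {1..n}. gcd x y = d}"
    then obtain x y where p: "p = (x, y)" and xy: "x \<in> {1..m}" "y \<in> {1..n}" "gcd x y = d"
      by auto
    obtain a b where ab: "x = d * a" "y = d * b"
      using xy(3) by (metis dvdE gcd_dvd1 gcd_dvd2)
    have "d * gcd a b = d"
      using xy(3) unfolding ab by (simp only: gcd_mult_distrib_nat)
    then have "gcd a b = 1"
      using assms by simp
    moreover have "a \<in> {1..m div d}" "b \<in> {1..n div d}"
      using xy assms unfolding ab
      by (auto simp: less_eq_div_iff_mult_less_eq mult.commute Suc_le_eq)
    ultimately have "(a, b) \<in> coprime_pairs \<inter> {1..m div d} \<times> {1..n div d}"
      by (auto simp: coprime_pairs_def Npos_def)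
    then show "p \<in> (\<lambda>(x, y). (d * x, d * y)) `
                   (coprime_pairs \<inter> {1..m div d} \<times> {1..n div d})"
      unfolding p ab by force
  next
    fix p assume "p \<in> (\<lambda>(x, y). (d * x, d * y)) `
                      (coprime_pairs \<inter> {1..m div d} \<times> {1..n div d})"
    then obtain a b where p: "p = (d * a, d * b)"
        and "(a, b) \<in> coprime_pairs \<inter> {1..m div d} \<times> {1..n div d}"
      by (elim imageE) (simp only: split_paired_all split_conv)
    then have ab: "gcd a b = 1" "a \<in> {1..m div d}" "b \<in> {1..n div d}"
      by (auto simp: coprime_pairs_def)
    have "gcd (d * a) (d * b) = d"
      using ab(1) gcd_mult_distrib_nat[of d a b] by simp
    then show "p \<in> {(x, y) \<in> {1..m} \<times> {1..n}. gcd x y = d}"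
      using ab assms unfolding p
      by (auto simp: less_eq_div_iff_mult_less_eq mult.commute Suc_le_eq)
  qed
  moreover have "inj_on (\<lambda>(x, y). (d * x, d * y)) A" for A
    using assms by (auto simp: inj_on_def)
  ultimately show ?thesis
    by (simp only: card_image)
qed

text \<open>The gcd of a pair in the box lies between 1 and its first coordinate, so the gcd classes
  for \<open>d\<close> up to \<open>m\<close> partition the box.\<close>

lemma sum_card_coprime_pairs:
  "(\<Sum>d=1..m. card (coprime_pairs \<inter> {1..m div d} \<times> {1..n div d})) = m * n"
proof -
  have "{1..m} \<times> {1..n} = (\<Union>d\<in>{1..m}. {(x, y) \<in> {1..m} \<times> {1..n}. gcd x y = d})"
    by (fastforce simp: Suc_le_eq intro: order_trans[OF gcd_le1_nat])
  then have "m * n = card (\<Union>d\<in>{1..m}. {(x, y) \<in> {1..m} \<times> {1..n}. gcd x y = d})"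
    by (metis card_atLeastAtMost card_cartesian_product diff_Suc_1)
  also have "\<dots> = (\<Sum>d=1..m. card {(x, y) \<in> {1..m} \<times> {1..n}. gcd x y = d})"
    by (rule card_UN_disjoint)
       (auto intro: finite_subset[of _ "{1..m} \<times> {1..n}"])
  also have "\<dots> = (\<Sum>d=1..m. card (coprime_pairs \<inter> {1..m div d} \<times> {1..n div d}))"
    by (rule sum.cong[OF refl card_gcd_eq]) simp
  finally show ?thesis ..
qed

section \<open>Shrunken boxes and their weights\<close>

definition scale_down :: "nat \<Rightarrow> nat \<times> nat \<Rightarrow> nat \<times> nat" where
  "scale_down d = (\<lambda>(m, n). (m div d, n div d))"

text \<open>The share of the box that the shrunken box takes up. As a product of one-variable
  ratios, it can be bounded and passed to the limit coordinatewise.\<close>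

definition scale_weight :: "nat \<Rightarrow> nat \<times> nat \<Rightarrow> real" where
  "scale_weight d = (\<lambda>(m, n). (real (m div d) / real m) * (real (n div d) / real n))"

text \<open>If the shrunken box is empty, both sides are 0, because division by zero yields 0;
  otherwise its area cancels.\<close>

lemma rect_freq_scale_down_mult_weight:
  "rect_freq C (scale_down d (m, n)) * scale_weight d (m, n) =
   real (card (C \<inter> {1..m div d} \<times> {1..n div d})) / (real m * real n)"
  by (cases "m div d = 0 \<or> n div d = 0")
     (auto simp: rect_freq_def scale_down_def scale_weight_def)

lemma rect_freq_bounds: "rect_freq C p \<in> {0..1}"
proof (cases p)
  case (Pair m n)
  have "card (C \<inter> {1..m} \<times> {1..n}) \<le> card ({1..m} \<times> {1..n})"
    by (intro card_mono) auto
  then have "real (card (C \<inter> {1..m} \<times> {1..n})) \<le> real m * real n"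
    by (simp flip: of_nat_mult)
  then show ?thesis
    unfolding Pair rect_freq_def by (cases "m = 0 \<or> n = 0") auto
qed

lemma div_ratio_le: "real (n div d) / real n \<le> 1 / real d"
proof (cases "n = 0")
  case False
  then show ?thesis
    using of_nat_div_le_of_nat[of n d, where 'a=real] by (simp add: divide_le_eq)
qed simp

lemma scale_weight_nonneg: "0 \<le> scale_weight d p"
  by (auto simp: scale_weight_def split: prod.split)

text \<open>Uniformity in \<open>p\<close> is the point: it supplies a summable majorant for
  exchanging limit and series.\<close>

lemma scale_weight_le: "scale_weight d p \<le> 1 / real d ^ 2"
  unfolding scale_weight_def power2_eq_square
  using mult_mono[OF div_ratio_le div_ratio_le] by (force split: prod.split)

text \<open>Rounding down loses at most 1, hence at most \<open>1 / n\<close> after division by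
  \<open>n\<close>.\<close>

lemma div_ratio_tendsto:
  assumes "d > 0"
  shows "(\<lambda>n. real (n div d) / real n) \<longlonglongrightarrow> 1 / real d"
proof (rule tendsto_sandwich)
  have "1 / real d - 1 / real n \<le> real (n div d) / real n" if "n > 0" for n
  proof -
    have "real n / real d - 1 \<le> real (n div d)"
      using floor_correct[of "real n / real d"] by (simp add: floor_divide_of_nat_eq)
    then have "(real n / real d - 1) / real n \<le> real (n div d) / real n"
      by (rule divide_right_mono) simp
    then show ?thesis
      using that by (simp add: diff_divide_distrib)
  qed
  then show "\<forall>\<^sub>F n in sequentially. 1 / real d - 1 / real n \<le> real (n div d) / real n"
    using eventually_gt_at_top[of 0] by (rule eventually_mono[rotated])
  show "(\<lambda>n. 1 / real d - 1 / real n) \<longlonglongrightarrow> 1 / real d"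
    using tendsto_diff[OF tendsto_const lim_1_over_n] by simp
  show "\<forall>\<^sub>F n in sequentially. real (n div d) / real n \<le> 1 / real d"
    by (simp add: div_ratio_le)
qed simp

lemma scale_weight_tendsto:
  assumes "d > 0"
  shows "(scale_weight d \<longlongrightarrow> 1 / real d ^ 2) min_at_top"
proof -
  have "(scale_weight d \<longlongrightarrow> 1 / real d * (1 / real d)) min_at_top"
    unfolding scale_weight_def min_at_top_eq_prod case_prod_beta
    by (intro tendsto_mult filterlim_compose[OF div_ratio_tendsto[OF assms]]
          filterlim_fst filterlim_snd)
  then show ?thesis
    by (simp add: power2_eq_square)
qed

text \<open>This carries an eventual bound on the error at \<open>p\<close> over to the shrunken
  box, for each fixed \<open>d\<close>.\<close>

lemma filterlim_scale_down:
  assumes "d > 0"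
  shows "filterlim (scale_down d) min_at_top min_at_top"
  unfolding scale_down_def min_at_top_eq_prod case_prod_beta
  by (intro filterlim_Pair filterlim_compose[OF filterlim_at_top_div_const_nat[OF assms]]
        filterlim_fst filterlim_snd)

section \<open>A bound on the sum of inverse squares\<close>

lemma inverse_squares_Suc_sums: "(\<lambda>k. 1 / real (Suc k) ^ 2) sums (pi\<^sup>2 / 6)"
  using inverse_squares_sums by (simp add: add.commute)

text \<open>Equivalently, the inverse squares from 2 on sum to at most 3/4. The term 1/4 is kept
  exactly; from 3 on, the terms are compared with a telescoping series of sum 1/2.\<close>

lemma pi_squared_le: "pi\<^sup>2 \<le> 21 / 2"
proof -
  have tail: "(\<lambda>k. 1 / real (Suc (Suc (Suc k))) ^ 2) sums (pi\<^sup>2 / 6 - 1 - 1 / 4)"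
    unfolding sums_Suc_iff[of "\<lambda>k. 1 / real (Suc k) ^ 2"]
      sums_Suc_iff[of "\<lambda>k. 1 / real (Suc (Suc k)) ^ 2"]
    using inverse_squares_Suc_sums by (simp add: power2_eq_square)
  have "(\<lambda>k. 1 / real (k + 2)) \<longlonglongrightarrow> 0"
    using LIMSEQ_ignore_initial_segment[OF lim_1_over_n, of 2] by simp
  then have telescope: "(\<lambda>k. 1 / real (k + 2) - 1 / real (Suc k + 2)) sums (1 / 2)"
    using telescope_sums' by fastforce
  have "1 / real (Suc (Suc (Suc k))) ^ 2 \<le> 1 / real (k + 2) - 1 / real (Suc k + 2)" for k
  proof -
    have "1 / real (Suc (Suc (Suc k))) ^ 2 \<le> 1 / (real (k + 2) * real (Suc k + 2))"
      unfolding power2_eq_square by (intro divide_left_mono mult_mono) auto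
    also have "\<dots> = 1 / real (k + 2) - 1 / real (Suc k + 2)"
      by (simp add: divide_simps)
    finally show ?thesis .
  qed
  from sums_le[OF this tail telescope] show ?thesis
    by simp
qed

section \<open>Contraction of the error\<close>

text \<open>For \<open>d > m\<close> the shrunken box is empty, so the gcd count extends to an
  infinite series whose index range does not depend on the box.\<close>

lemma coprime_pairs_freq_sums:
  assumes "m > 0" "n > 0"
  shows "(\<lambda>k. rect_freq coprime_pairs (scale_down (Suc k) (m, n)) * scale_weight (Suc k) (m, n))
         sums 1"
proof -
  let ?g = "\<lambda>d. real (card (coprime_pairs \<inter> {1..m div d} \<times> {1..n div d})) / (real m * real n)"
  have "(\<lambda>k. ?g (Suc k)) sums (\<Sum>k<m. ?g (Suc k))"
    by (rule sums_finite) auto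
  also have "(\<Sum>k<m. ?g (Suc k)) = (\<Sum>d=1..m. ?g d)"
    by (simp add: sum.atLeast1_atMost_eq)
  also have "\<dots> = 1"
    using assms sum_card_coprime_pairs[of m n]
    by (simp flip: sum_divide_distrib of_nat_sum of_nat_mult)
  finally show ?thesis
    by (simp only: rect_freq_scale_down_mult_weight)
qed

text \<open>The factor 7/8 is 3/4, from the inverse squares beyond the first, plus 1/8 to absorb a
  remainder that tends to 0.\<close>

lemma coprime_freq_error_contraction:
  assumes B: "B > 0" "\<forall>\<^sub>F p in min_at_top. \<bar>rect_freq coprime_pairs p - 6 / pi\<^sup>2\<bar> \<le> B"
  shows "\<forall>\<^sub>F p in min_at_top. \<bar>rect_freq coprime_pairs p - 6 / pi\<^sup>2\<bar> \<le> 7 / 8 * B"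
proof -
  define f where "f = rect_freq coprime_pairs"
  define c where "c = 6 / pi\<^sup>2"
  define s where "s k = 1 / real (Suc k) ^ 2" for k
  define w where "w k = scale_weight (Suc k)" for k
  define e where "e k p = \<bar>f (scale_down (Suc k) p) - c\<bar>" for k p
  \<comment> \<open>The remainder in the \<open>k\<close>-th term: the excess of the error over
    \<open>B\<close>, which eventually vanishes for each fixed \<open>k\<close>, and the defect of
    the weight from its limit.\<close>
  define h where "h k p = max 0 (e k p - B) * s k + c * (s k - w k p)" for k p
  define q where "q = pi\<^sup>2 / 6 - 1"
  have c: "c > 0" by (simp add: c_def)
  have w: "0 \<le> w k p" "w k p \<le> s k" for k p
    unfolding w_def s_def by (rule scale_weight_nonneg scale_weight_le)+
  have s: "s sums (pi\<^sup>2 / 6)"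
    unfolding s_def by (rule inverse_squares_Suc_sums)
  have s_Suc: "(\<lambda>k. s (Suc k)) sums q"
    unfolding sums_Suc_iff using s by (simp add: q_def s_def[of 0])
  have e: "e k p \<le> 1 + c" for k p
    using rect_freq_bounds[of coprime_pairs "scale_down (Suc k) p"] c
    by (auto simp: e_def f_def)
  have h_bound: "\<bar>h k p\<bar> \<le> (1 + 2 * c) * s k" for k p
  proof -
    have "0 \<le> max 0 (e k p - B) * s k"
      by (simp add: s_def)
    moreover have "max 0 (e k p - B) * s k \<le> (1 + c) * s k"
      using e[of k p] B c by (intro mult_right_mono) (auto simp: s_def)
    moreover have "0 \<le> c * (s k - w k p)" "c * (s k - w k p) \<le> c * s k"
      using c w[of k p] by auto
    ultimately show ?thesis
      unfolding h_def by (simp add: algebra_simps)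
  qed
  have h_tendsto: "(h k \<longlongrightarrow> 0) min_at_top" for k
  proof -
    have "\<forall>\<^sub>F p in min_at_top. e k p \<le> B"
      unfolding e_def f_def c_def
      by (rule eventually_compose_filterlim[OF B(2) filterlim_scale_down]) simp
    then have "\<forall>\<^sub>F p in min_at_top. max 0 (e k p - B) * s k = 0"
      by eventually_elim simp
    then have "((\<lambda>p. max 0 (e k p - B) * s k) \<longlongrightarrow> 0) min_at_top"
      by (rule tendsto_eventually)
    moreover have "((\<lambda>p. c * (s k - w k p)) \<longlongrightarrow> c * (s k - s k)) min_at_top"
      unfolding w_def by (intro tendsto_intros) (simp only: s_def scale_weight_tendsto zero_less_Suc)
    ultimately show ?thesis
      unfolding h_def using tendsto_add by fastforce
  qed
  have h_summable: "summable (\<lambda>k. h (Suc k) p)" for p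
    using h_bound
    by (intro summable_comparison_test[
          OF _ summable_mult[OF sums_summable[OF s_Suc], of "1 + 2 * c"]])
       simp
  \<comment> \<open>How far out the box must be for the excess to vanish depends on
    \<open>k\<close>, so termwise limits alone do not suffice; the majorant of
    \<open>h_bound\<close> permits the exchange by Tannery's theorem.\<close>
  have "((\<lambda>p. \<Sum>k. h (Suc k) p) \<longlongrightarrow> (\<Sum>k. 0)) min_at_top"
    using tannerys_theorem[of "\<lambda>k. h (Suc k)" "\<lambda>_. 0" min_at_top
        "\<lambda>k. (1 + 2 * c) * s (Suc k)"]
      h_tendsto h_bound summable_mult[OF sums_summable[OF s_Suc]] min_at_top_neq_bot
    by (simp add: case_prod_unfold)
  then have "\<forall>\<^sub>F p in min_at_top. (\<Sum>k. h (Suc k) p) < B / 8"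
    using B(1) by (intro order_tendstoD(2)) auto
  moreover have "\<forall>\<^sub>F p in min_at_top. fst p > 0 \<and> snd p > 0"
    unfolding eventually_min_at_top by (intro exI[of _ 1]) auto
  ultimately show ?thesis
  proof eventually_elim
    case (elim p)
    define g where "g k = f (scale_down (Suc k) p) * w k p - c * s k" for k
    have g_le: "\<bar>g k\<bar> \<le> B * s k + h k p" for k
    proof -
      have "\<bar>g k\<bar> = \<bar>(f (scale_down (Suc k) p) - c) * w k p + c * (w k p - s k)\<bar>"
        by (simp add: g_def algebra_simps)
      also have "\<dots> \<le> e k p * w k p + c * (s k - w k p)"
        using w[of k p] c by (intro order_trans[OF abs_triangle_ineq]) (simp add: abs_mult e_def)
      also have "e k p * w k p \<le> (B + max 0 (e k p - B)) * s k"
        using w[of k p] B(1) by (intro mult_mono) auto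
      finally show ?thesis
        by (simp add: h_def algebra_simps)
    qed
    have "(\<lambda>k. f (scale_down (Suc k) p) * w k p) sums 1"
      using coprime_pairs_freq_sums[of "fst p" "snd p"] elim by (simp add: f_def w_def)
    moreover have "(\<lambda>k. c * s k) sums 1"
      using sums_mult[OF s, of c] by (simp add: c_def)
    ultimately have "g sums 0"
      unfolding g_def using sums_diff by fastforce
    \<comment> \<open>For \<open>d = 1\<close> nothing is shrunk and the weight is 1, so the first
      term is the error at \<open>p\<close> itself. As \<open>g\<close> sums to 0, the other terms
      must sum to its negative.\<close>
    moreover have "g 0 = f p - c"
      using elim by (cases p) (simp add: g_def s_def w_def scale_down_def scale_weight_def)
    ultimately have g_Suc: "(\<lambda>k. g (Suc k)) sums - (f p - c)"
      by (simp add: sums_Suc_iff)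
    have bound_sums: "(\<lambda>k. B * s (Suc k) + h (Suc k) p) sums (B * q + (\<Sum>k. h (Suc k) p))"
      using s_Suc h_summable by (intro sums_add sums_mult summable_sums)
    have "\<bar>f p - c\<bar> \<le> B * q + (\<Sum>k. h (Suc k) p)"
      using norm_suminf_le[of "\<lambda>k. g (Suc k)" "\<lambda>k. B * s (Suc k) + h (Suc k) p"]
        g_le sums_summable[OF bound_sums] sums_unique[OF g_Suc] sums_unique[OF bound_sums]
      by simp
    also have "B * q \<le> B * (3 / 4)"
      using B(1) pi_squared_le by (intro mult_left_mono) (auto simp: q_def)
    finally show ?case
      using elim by (simp add: f_def c_def)
  qed
qed

section \<open>The limit and its consequences\<close>

lemma rect_freq_coprime_pairs_tendsto:
  "(rect_freq coprime_pairs \<longlongrightarrow> 6 / pi\<^sup>2) min_at_top"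
proof (rule tendstoI)
  fix \<epsilon> :: real
  assume "\<epsilon> > 0"
  \<comment> \<open>A starting bound valid for every box, since frequencies lie between 0 and
    1.\<close>
  let ?B = "1 + 6 / pi\<^sup>2"
  have B: "?B > 0"
    by (simp add: add_pos_pos)
  have bound: "\<forall>\<^sub>F p in min_at_top.
      \<bar>rect_freq coprime_pairs p - 6 / pi\<^sup>2\<bar> \<le> (7 / 8) ^ j * ?B" for j
  proof (induction j)
    case 0
    have "0 < 6 / pi\<^sup>2"
      by simp
    then have "\<bar>rect_freq coprime_pairs p - 6 / pi\<^sup>2\<bar> \<le> ?B" for p
      using rect_freq_bounds[of coprime_pairs p] unfolding atLeastAtMost_iff by linarith
    then show ?case
      by simp
  next
    case (Suc j)
    then show ?case
      using coprime_freq_error_contraction[of "(7 / 8) ^ j * ?B"] B by (simp add: mult_ac)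
  qed
  have "(\<lambda>j. (7 / 8) ^ j * ?B) \<longlonglongrightarrow> 0"
    by (intro tendsto_mult_left_zero LIMSEQ_realpow_zero) auto
  then have "\<forall>\<^sub>F j in sequentially. (7 / 8) ^ j * ?B < \<epsilon>"
    using \<open>\<epsilon> > 0\<close> by (rule order_tendstoD(2))
  \<comment> \<open>The region where the bound holds may depend on \<open>j\<close>, but a single
    \<open>j\<close> serves for the given \<epsilon>.\<close>
  then obtain j where "(7 / 8) ^ j * ?B < \<epsilon>"
    unfolding eventually_sequentially by blast
  with bound[of j] show "\<forall>\<^sub>F p in min_at_top. dist (rect_freq coprime_pairs p) (6 / pi\<^sup>2) < \<epsilon>"
    by (auto simp: dist_real_def elim: eventually_mono)
qed

theorem theorem3p2:
  shows "(rect_freq coprime_pairs \<longlongrightarrow> 6 / pi\<^sup>2) min_at_top \<and>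
         coprime_pairs \<in> CF2 \<and>
         (\<forall>\<mu>\<in>MF2. \<mu> coprime_pairs = 6 / pi\<^sup>2)"
proof (intro conjI ballI)
  show lim: "(rect_freq coprime_pairs \<longlongrightarrow> 6 / pi\<^sup>2) min_at_top"
    by (rule rect_freq_coprime_pairs_tendsto)
  show CF2: "coprime_pairs \<in> CF2"
    using lim by (auto simp: CF2_def coprime_pairs_def)
  fix \<mu> assume "\<mu> \<in> MF2"
  then have "(rect_freq coprime_pairs \<longlongrightarrow> \<mu> coprime_pairs) min_at_top"
    using CF2 by (auto simp: MF2_def)
  then show "\<mu> coprime_pairs = 6 / pi\<^sup>2"
    using tendsto_unique[OF min_at_top_neq_bot] lim by blast
qed

end
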